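(* Let $\rho>0$ and let $\Phi:B_{\rho}\to H$ be a $C^1$ function with Lipschitzian derivative. Then, the following assertions are equivalent: (i) for each $r>0$ small enough, there exists a unique $x^*\in S_r$ such that $$\max\{\langle\Phi(x^* ),x^*-x\rangle,\langle\Phi(x),x^*-x\rangle\}<0$$ for all $x\in B_r\setminus\{x^*\}$; (ii) $\Phi(0)\neq 0$.
   Context: $(H,\langle\cdot,\cdot\rangle)$ is a real Hilbert space. For each $r>0$, $B_r=\{x\in H:\|x\|\leq r\}$ and $S_r=\{x\in H:\|x\|=r\}$. The derivative of $\Phi$ is the Fréchet derivative, with values in the space $\mathcal{L}(H)$ of bounded linear operators on $H$ with the operator norm. "For each $r>0$ small enough" means: there is $r^*\in\,]0,\rho]$ such that the property holds for every $r\in\,]0,r^*]$. *)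

theory Defs
  imports "HOL-Analysis.Analysis"
begin

end

theory Submission
  imports Defs
begin

text \<open>
  Taking \<open>x = 0\<close> in the second inequality of (i) gives \<open>\<Phi> 0 \<bullet> z < 0\<close>, so (i) implies (ii).

  Conversely, only the Lipschitz continuity of \<open>\<Phi>\<close> matters; it follows from the boundedness of
  the derivative on the ball. The first inequality says that \<open>z\<close> is the strict minimizer over
  \<open>cball 0 r\<close> of the linear functional given by \<open>\<Phi> z\<close>, i.e. that \<open>z = - r *\<^sub>R sgn (\<Phi> z)\<close>. If
  \<open>\<Phi> 0 \<noteq> 0\<close>, then \<open>\<Phi>\<close> is bounded away from 0 near the origin, so \<open>x \<mapsto> - r *\<^sub>R sgn (\<Phi> x)\<close> has a
  Lipschitz constant proportional to \<open>r\<close>; for small \<open>r\<close> it is a contraction, and Banach's theorem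
  provides \<open>z\<close>. Since the ball of radius \<open>r\<close> is uniformly convex, \<open>\<Phi> z \<bullet> (z - x)\<close> is even at most
  \<open>- (norm (\<Phi> z) / (2 * r)) * (norm (z - x))\<^sup>2\<close>. Replacing \<open>\<Phi> z\<close> by \<open>\<Phi> x\<close> costs at most
  \<open>M * (norm (z - x))\<^sup>2\<close>, where \<open>M\<close> is a Lipschitz constant of \<open>\<Phi>\<close>, so for small \<open>r\<close> the second
  inequality holds as well.

  Uniqueness needs no smallness: for two solutions \<open>z\<close> and \<open>w\<close>, the first inequality for \<open>z\<close> and
  the second one for \<open>w\<close> say that \<open>\<Phi> z \<bullet> (z - w)\<close> is both negative and positive.
\<close>

lemma norm_sgn_diff_le:
  fixes u v :: "'a::real_normed_vector"
  assumes "m > 0" "norm u \<ge> m" "norm v \<ge> m"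
  shows "norm (sgn u - sgn v) \<le> 2 * norm (u - v) / m"
proof -
  have u: "norm u > 0" and v: "norm v > 0" using assms by linarith+
  have "sgn u - sgn v = (u - v) /\<^sub>R norm u + ((norm v - norm u) / norm u) *\<^sub>R sgn v"
  proof -
    have "inverse (norm u) = inverse (norm v) + (norm v - norm u) / norm u * inverse (norm v)"
      using u v by (simp add: field_simps)
    then have "v /\<^sub>R norm u = sgn v + ((norm v - norm u) / norm u) *\<^sub>R sgn v"
      unfolding sgn_div_norm scaleR_scaleR by (metis scaleR_add_left)
    then show ?thesis
      by (simp add: sgn_div_norm[of u] scaleR_diff_right)
  qed
  also have "norm \<dots> \<le> norm (u - v) / norm u + \<bar>norm v - norm u\<bar> / norm u"
    using u v by (intro norm_triangle_le) (simp add: norm_sgn divide_inverse_commute abs_mult)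
  also have "\<dots> \<le> norm (u - v) / norm u + norm (u - v) / norm u"
    using norm_triangle_ineq3[of u v] u by (intro add_left_mono divide_right_mono) auto
  also have "\<dots> = 2 * norm (u - v) / norm u" by simp
  also have "\<dots> \<le> 2 * norm (u - v) / m"
    using assms u by (intro divide_left_mono) auto
  finally show ?thesis .
qed

lemma lipschitz_on_cball_of_lipschitz_derivative:
  fixes \<Phi> :: "'a::real_normed_vector \<Rightarrow> 'b::real_normed_vector" and \<Phi>' :: "'a \<Rightarrow> 'a \<Rightarrow>\<^sub>L 'b"
  assumes "\<rho> \<ge> 0"
    and deriv: "\<And>x. x \<in> cball 0 \<rho> \<Longrightarrow>
      (\<Phi> has_derivative blinfun_apply (\<Phi>' x)) (at x within cball 0 \<rho>)"
    and L: "L-lipschitz_on (cball 0 \<rho>) \<Phi>'"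
  shows "(norm (\<Phi>' 0) + L * \<rho>)-lipschitz_on (cball 0 \<rho>) \<Phi>"
proof -
  have bound: "norm (\<Phi>' x) \<le> norm (\<Phi>' 0) + L * \<rho>" if x: "x \<in> cball 0 \<rho>" for x
  proof -
    have "norm (\<Phi>' x - \<Phi>' 0) \<le> L * norm x"
      using lipschitz_onD[OF L x, of 0] \<open>\<rho> \<ge> 0\<close> by (simp add: dist_norm)
    also have "\<dots> \<le> L * \<rho>"
      using x lipschitz_on_nonneg[OF L] by (intro mult_left_mono) auto
    finally show ?thesis using norm_triangle_ineq2[of "\<Phi>' x" "\<Phi>' 0"] by linarith
  qed
  show ?thesis
  proof (rule lipschitz_onI)
    fix x y :: 'a assume "x \<in> cball 0 \<rho>" "y \<in> cball 0 \<rho>"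
    then show "dist (\<Phi> x) (\<Phi> y) \<le> (norm (\<Phi>' 0) + L * \<rho>) * dist x y"
      unfolding dist_norm using deriv bound
      by (intro differentiable_bound[of "cball 0 \<rho>" \<Phi> "\<lambda>x. blinfun_apply (\<Phi>' x)"])
        (auto simp flip: norm_blinfun.rep_eq)
  next
    show "0 \<le> norm (\<Phi>' 0) + L * \<rho>"
      using \<open>\<rho> \<ge> 0\<close> lipschitz_on_nonneg[OF L] by simp
  qed
qed

text \<open>The existence part: for a field bounded below in norm by \<open>m\<close> on the ball, a Lipschitz
  constant \<open>M\<close> with \<open>4 * M * r \<le> m\<close> is small enough: it makes \<open>x \<mapsto> - r *\<^sub>R sgn (\<Phi> x)\<close> a contraction with
  constant \<open>1/2\<close>, and it gives \<open>M < m / (2 * r)\<close>, as the second inequality requires.\<close>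

lemma exists_strict_variational_solution:
  fixes \<Phi> :: "'a::{real_inner, complete_space} \<Rightarrow> 'a"
  assumes "r > 0" "m > 0" and lip: "M-lipschitz_on (cball 0 r) \<Phi>"
    and small: "4 * M * r \<le> m"
    and lower: "\<And>x. x \<in> cball 0 r \<Longrightarrow> norm (\<Phi> x) \<ge> m"
  obtains z where "z \<in> sphere 0 r"
    and "\<And>x. x \<in> cball 0 r - {z} \<Longrightarrow> \<Phi> z \<bullet> (z - x) < 0"
    and "\<And>x. x \<in> cball 0 r - {z} \<Longrightarrow> \<Phi> x \<bullet> (z - x) < 0"
proof -
  define T where "T x = - r *\<^sub>R sgn (\<Phi> x)" for x
  have norm_T: "norm (T x) = r" if "x \<in> cball 0 r" for x
    using lower[OF that] assms(1,2) by (auto simp: T_def norm_sgn)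
  have contr: "dist (T x) (T y) \<le> 1/2 * dist x y"
    if x: "x \<in> cball 0 r" and y: "y \<in> cball 0 r" for x y
  proof -
    have "dist (T x) (T y) = r * norm (sgn (\<Phi> x) - sgn (\<Phi> y))"
      using \<open>r > 0\<close>
      by (simp add: T_def dist_norm norm_minus_commute flip: scaleR_diff_right)
    also have "\<dots> \<le> r * (2 * norm (\<Phi> x - \<Phi> y) / m)"
      using norm_sgn_diff_le[OF \<open>m > 0\<close> lower[OF x] lower[OF y]] \<open>r > 0\<close>
      by (intro mult_left_mono) auto
    also have "\<dots> \<le> r * (2 * (M * dist x y) / m)"
      using lipschitz_onD[OF lip x y] \<open>r > 0\<close> \<open>m > 0\<close>
      by (intro mult_left_mono divide_right_mono) (auto simp: dist_norm)
    also have "\<dots> = (4 * M * r / m) * (1/2 * dist x y)" by simp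
    also have "\<dots> \<le> 1 * (1/2 * dist x y)"
      using small \<open>m > 0\<close> by (intro mult_right_mono) auto
    finally show ?thesis by simp
  qed
  have "\<exists>!z. z \<in> cball 0 r \<and> T z = z"
    by (rule Banach_fix[where c = "1/2"])
      (use contr norm_T \<open>r > 0\<close> in \<open>auto simp: complete_eq_closed\<close>)
  then obtain z where z: "z \<in> cball 0 r" and fix_z: "T z = z" by blast
  have norm_z: "norm z = r" using norm_T[OF z] fix_z by simp
  have "norm (\<Phi> z) > 0" using lower[OF z] \<open>m > 0\<close> by linarith
  then have z_dir: "\<Phi> z = - (norm (\<Phi> z) / r) *\<^sub>R z"
    using arg_cong[OF fix_z, of "\<lambda>u. - (norm (\<Phi> z) / r) *\<^sub>R u"] \<open>r > 0\<close>
    by (simp add: T_def sgn_div_norm)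
  have pos: "(norm (z - x))\<^sup>2 > 0" if "x \<in> cball 0 r - {z}" for x
    using that by auto
  have at_z: "\<Phi> z \<bullet> (z - x) \<le> - (m / (2 * r)) * (norm (z - x))\<^sup>2" if x: "x \<in> cball 0 r" for x
  proof -
    have "(norm x)\<^sup>2 \<le> r\<^sup>2" using x by (intro power_mono) auto
    \<comment> \<open>\<open>(norm x)\<^sup>2 = (norm z)\<^sup>2 - 2 * (z \<bullet> (z - x)) + (norm (z - x))\<^sup>2\<close> and \<open>norm z = r\<close>.\<close>
    then have half: "z \<bullet> (z - x) \<ge> (norm (z - x))\<^sup>2 / 2"
      unfolding norm_z[symmetric] power2_norm_eq_inner
      by (simp add: inner_diff_left inner_diff_right inner_commute)
    have "m / (2 * r) * (norm (z - x))\<^sup>2 = (m / r) * ((norm (z - x))\<^sup>2 / 2)" by simp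
    also have "\<dots> \<le> (norm (\<Phi> z) / r) * (z \<bullet> (z - x))"
      using half lower[OF z] \<open>r > 0\<close> \<open>m > 0\<close>
      by (intro mult_mono divide_right_mono) auto
    also have "\<dots> = - (\<Phi> z \<bullet> (z - x))"
      by (subst (2) z_dir) simp
    finally show ?thesis by simp
  qed
  show thesis
  proof
    show "z \<in> sphere 0 r" using norm_z by simp
  next
    fix x assume x: "x \<in> cball 0 r - {z}"
    have "m / (2 * r) * (norm (z - x))\<^sup>2 > 0"
      using pos[OF x] \<open>r > 0\<close> \<open>m > 0\<close> by (intro mult_pos_pos) auto
    then show "\<Phi> z \<bullet> (z - x) < 0" using at_z[of x] x by auto
  next
    fix x assume x: "x \<in> cball 0 r - {z}"
    have "(\<Phi> x - \<Phi> z) \<bullet> (z - x) \<le> norm (\<Phi> x - \<Phi> z) * norm (z - x)"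
      by (rule norm_cauchy_schwarz)
    also have "\<dots> \<le> (M * norm (z - x)) * norm (z - x)"
      using lipschitz_onD[OF lip _ z, of x] x
      by (intro mult_right_mono) (auto simp: dist_norm norm_minus_commute)
    also have "\<dots> = M * (norm (z - x))\<^sup>2" by (simp add: power2_eq_square)
    finally have "\<Phi> x \<bullet> (z - x) \<le> (M - m / (2 * r)) * (norm (z - x))\<^sup>2"
      using at_z[of x] x by (simp add: inner_diff_left algebra_simps)
    also have "\<dots> < 0"
    proof -
      have "M \<le> m / (4 * r)" using small \<open>r > 0\<close> by (simp add: field_simps)
      also have "\<dots> < m / (2 * r)" using \<open>r > 0\<close> \<open>m > 0\<close> by (simp add: field_simps)
      finally show ?thesis using pos[OF x] by (intro mult_neg_pos) auto
    qed
    finally show "\<Phi> x \<bullet> (z - x) < 0" .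
  qed
qed

theorem theorem3:
  fixes \<rho> :: real
    and \<Phi> :: "'a::{real_inner, complete_space} \<Rightarrow> 'a"
    and \<Phi>' :: "'a \<Rightarrow> 'a \<Rightarrow>\<^sub>L 'a"
  assumes rho_pos: "\<rho> > 0"
    and deriv: "\<And>x. x \<in> cball 0 \<rho> \<Longrightarrow>
      (\<Phi> has_derivative blinfun_apply (\<Phi>' x)) (at x within cball 0 \<rho>)"
    and deriv_cont: "continuous_on (cball 0 \<rho>) \<Phi>'"
    and deriv_lipschitz: "\<exists>L. L-lipschitz_on (cball 0 \<rho>) \<Phi>'"
  shows "(\<exists>r0. 0 < r0 \<and> r0 \<le> \<rho> \<and>
            (\<forall>r. 0 < r \<and> r \<le> r0 \<longrightarrow>
              (\<exists>!z. z \<in> sphere 0 r \<and>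
                (\<forall>x \<in> cball 0 r - {z}.
                  max (\<Phi> z \<bullet> (z - x)) (\<Phi> x \<bullet> (z - x)) < 0))))
         \<longleftrightarrow> \<Phi> 0 \<noteq> 0"
    (is "(\<exists>r0. 0 < r0 \<and> r0 \<le> \<rho> \<and> (\<forall>r. 0 < r \<and> r \<le> r0 \<longrightarrow> (\<exists>!z. ?P r z))) \<longleftrightarrow> _")
proof
  assume "\<exists>r0. 0 < r0 \<and> r0 \<le> \<rho> \<and> (\<forall>r. 0 < r \<and> r \<le> r0 \<longrightarrow> (\<exists>!z. ?P r z))"
  then obtain r z where "r > 0" and z: "?P r z" by blast
  then have "0 \<in> cball 0 r - {z}" by auto
  with z have "\<Phi> 0 \<bullet> (z - 0) < 0" by (meson max_less_iff_conj)
  then show "\<Phi> 0 \<noteq> 0" by auto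
next
  assume nz: "\<Phi> 0 \<noteq> 0"
  define m where "m = norm (\<Phi> 0) / 2"
  have m: "m > 0" using nz by (simp add: m_def)
  obtain L where L: "L-lipschitz_on (cball 0 \<rho>) \<Phi>'" using deriv_lipschitz by blast
  \<comment> \<open>Adding 1 makes the constant positive, so that it can be divided by.\<close>
  define M where "M = norm (\<Phi>' 0) + L * \<rho> + 1"
  have lip: "M-lipschitz_on (cball 0 \<rho>) \<Phi>"
    by (rule lipschitz_on_le[OF lipschitz_on_cball_of_lipschitz_derivative[OF _ deriv L]])
      (use rho_pos in \<open>auto simp: M_def\<close>)
  have "L * \<rho> \<ge> 0" using lipschitz_on_nonneg[OF L] rho_pos by simp
  then have M: "M > 0" unfolding M_def using norm_ge_zero[of "\<Phi>' 0"] by linarith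
  define r0 where "r0 = min \<rho> (m / (4 * M))"
  have "\<exists>!z. ?P r z" if r: "0 < r" "r \<le> r0" for r
  proof -
    have r_rho: "r \<le> \<rho>" and "r \<le> m / (4 * M)" using r by (auto simp: r0_def)
    then have small: "4 * M * r \<le> m" using M by (simp add: field_simps)
    have sub: "cball 0 r \<subseteq> cball (0::'a) \<rho>" using r_rho by auto
    have lower: "norm (\<Phi> x) \<ge> m" if x: "x \<in> cball 0 r" for x
    proof -
      have "norm (\<Phi> x - \<Phi> 0) \<le> M * norm x"
        using lipschitz_onD[OF lip, of x 0] x sub rho_pos by (auto simp: dist_norm)
      also have "\<dots> \<le> M * r" using x M by (intro mult_left_mono) auto
      also have "\<dots> \<le> m" using small mult_pos_pos[OF M r(1)] by linarith
      finally show ?thesis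
        using norm_triangle_ineq2[of "\<Phi> 0" "\<Phi> x"] by (simp add: m_def norm_minus_commute)
    qed
    obtain z where "z \<in> sphere 0 r"
      and "\<And>x. x \<in> cball 0 r - {z} \<Longrightarrow> \<Phi> z \<bullet> (z - x) < 0"
      and "\<And>x. x \<in> cball 0 r - {z} \<Longrightarrow> \<Phi> x \<bullet> (z - x) < 0"
      using exists_strict_variational_solution
        [OF r(1) m lipschitz_on_subset[OF lip sub] small lower] by blast
    then have "?P r z" by simp
    moreover have "w = z" if "?P r w" "?P r z" for w z
    proof (rule ccontr)
      assume "w \<noteq> z"
      with that have "\<Phi> z \<bullet> (z - w) < 0" "\<Phi> z \<bullet> (w - z) < 0"
        by auto
      then show False by (simp add: inner_diff_right)
    qed
    ultimately show ?thesis by blast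
  qed
  then have "\<forall>r. 0 < r \<and> r \<le> r0 \<longrightarrow> (\<exists>!z. ?P r z)" by iprover
  moreover have "0 < r0" "r0 \<le> \<rho>" using rho_pos m M by (auto simp: r0_def)
  ultimately show "\<exists>r0. 0 < r0 \<and> r0 \<le> \<rho> \<and> (\<forall>r. 0 < r \<and> r \<le> r0 \<longrightarrow> (\<exists>!z. ?P r z))"
    by (intro exI conjI)
qed

end
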